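(* Let $m,n,p,q$ be natural numbers. If $p \geqslant 2q$ and $n \geqslant q+1$, then Maker has a winning strategy for the $(p,q)$-crossing game on $\Lambda_{m\times n}$.
   Context: $\Lambda_{m\times n}$ is the grid graph with vertex set $\{(x,y): x\in[m], y\in[n]\}$ (where $[k]=\{1,\dots,k\}$), two vertices being adjacent iff they are at Euclidean distance $1$; so each row has $m$ vertices and each column has $n$ vertices. A left-right crossing path is a path in the board joining some vertex $(1,y)$ to some vertex $(m,y')$. The $(p,q)$-crossing game on $\Lambda_{m\times n}$: two players, Maker and Breaker, alternate turns, Maker first. On each of her turns Maker claims $p$ as-yet unclaimed edges; on each of his turns Breaker claims $q$ as-yet unclaimed edges (destroying them). Maker wins if she claims all edges of some left-right crossing path; Breaker wins if the board reaches a state where Maker can never claim such a path. *)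

theory Defs
  imports "HOL-Analysis.Analysis"
begin

section \<open>Maker-Breaker games with biases\<close>

text \<open>
  A history is the list of the sets of board elements claimed on successive turns.
  Maker moves on the turns numbered 0, 2, 4, \<dots> and Breaker on the turns 1, 3, 5, \<dots>
\<close>

definition unclaimed :: "'e set \<Rightarrow> 'e set list \<Rightarrow> 'e set" where
  "unclaimed E h = E - \<Union> (set h)"

definition maker_claimed :: "'e set list \<Rightarrow> 'e set" where
  "maker_claimed h = \<Union> {h ! t |t. t < length h \<and> even t}"

definition bias :: "nat \<Rightarrow> nat \<Rightarrow> nat \<Rightarrow> nat" where
  "bias p q t = (if even t then p else q)"

text \<open>
  A player who may claim \<open>k\<close> elements claims exactly \<open>k\<close> of them, except that
  all the remaining ones are claimed when fewer than \<open>k\<close> are left.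
\<close>

definition legal_move :: "'e set \<Rightarrow> nat \<Rightarrow> 'e set list \<Rightarrow> 'e set \<Rightarrow> bool" where
  "legal_move E k h X \<longleftrightarrow>
     X \<subseteq> unclaimed E h \<and> card X = min k (card (unclaimed E h))"

definition legal_history :: "'e set \<Rightarrow> nat \<Rightarrow> nat \<Rightarrow> 'e set list \<Rightarrow> bool" where
  "legal_history E p q h \<longleftrightarrow>
     (\<forall>t < length h. legal_move E (bias p q t) (take t h) (h ! t))"

text \<open>
  A play is an infinite sequence of moves. On a finite board all moves are empty once
  every element is claimed. Playing on after the game is decided does not
  change its outcome: Maker never loses an element, and Maker has not won
  in a play exactly when she never holds a winning set.
\<close>

definition history :: "(nat \<Rightarrow> 'e set) \<Rightarrow> nat \<Rightarrow> 'e set list" where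
  "history w t = map w [0..<t]"

definition legal_play :: "'e set \<Rightarrow> nat \<Rightarrow> nat \<Rightarrow> (nat \<Rightarrow> 'e set) \<Rightarrow> bool" where
  "legal_play E p q w \<longleftrightarrow> (\<forall>t. legal_move E (bias p q t) (history w t) (w t))"

definition maker_strategy ::
    "'e set \<Rightarrow> nat \<Rightarrow> nat \<Rightarrow> ('e set list \<Rightarrow> 'e set) \<Rightarrow> bool" where
  "maker_strategy E p q \<sigma> \<longleftrightarrow>
     (\<forall>h. legal_history E p q h \<and> even (length h) \<longrightarrow> legal_move E p h (\<sigma> h))"

definition follows :: "('e set list \<Rightarrow> 'e set) \<Rightarrow> (nat \<Rightarrow> 'e set) \<Rightarrow> bool" where
  "follows \<sigma> w \<longleftrightarrow> (\<forall>t. even t \<longrightarrow> w t = \<sigma> (history w t))"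

text \<open>\<open>\<W>\<close> is the family of winning sets; Maker wins once she has claimed all of one of them.\<close>

definition maker_wins :: "'e set set \<Rightarrow> (nat \<Rightarrow> 'e set) \<Rightarrow> bool" where
  "maker_wins \<W> w \<longleftrightarrow> (\<exists>t. \<exists>S \<in> \<W>. S \<subseteq> maker_claimed (history w t))"

definition maker_winning_strategy ::
    "'e set \<Rightarrow> 'e set set \<Rightarrow> nat \<Rightarrow> nat \<Rightarrow> ('e set list \<Rightarrow> 'e set) \<Rightarrow> bool" where
  "maker_winning_strategy E \<W> p q \<sigma> \<longleftrightarrow>
     maker_strategy E p q \<sigma> \<and>
     (\<forall>w. legal_play E p q w \<and> follows \<sigma> w \<longrightarrow> maker_wins \<W> w)"

section \<open>The crossing game on the grid\<close>

definition grid_vertices :: "nat \<Rightarrow> nat \<Rightarrow> (nat \<times> nat) set" where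
  "grid_vertices m n = {1..m} \<times> {1..n}"

text \<open>
  The metric on the product type is the Euclidean one, but \<^typ>\<open>nat\<close> itself carries no
  metric in the library, hence the coordinates are embedded into the reals.
\<close>

definition grid_edges :: "nat \<Rightarrow> nat \<Rightarrow> (nat \<times> nat) set set" where
  "grid_edges m n =
     {{(x, y), (x', y')} |x y x' y'.
        (x, y) \<in> grid_vertices m n \<and> (x', y') \<in> grid_vertices m n \<and>
        dist (real x, real y) (real x', real y') = 1}"

definition grid_path :: "nat \<Rightarrow> nat \<Rightarrow> (nat \<times> nat) list \<Rightarrow> bool" where
  "grid_path m n vs \<longleftrightarrow>
     vs \<noteq> [] \<and> distinct vs \<and> set vs \<subseteq> grid_vertices m n \<and>
     successively (\<lambda>u v. {u, v} \<in> grid_edges m n) vs"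

definition path_edges :: "'v list \<Rightarrow> 'v set set" where
  "path_edges vs = {{vs ! i, vs ! Suc i} |i. Suc i < length vs}"

definition left_right_crossing :: "nat \<Rightarrow> nat \<Rightarrow> (nat \<times> nat) list \<Rightarrow> bool" where
  "left_right_crossing m n vs \<longleftrightarrow>
     grid_path m n vs \<and> fst (hd vs) = 1 \<and> fst (last vs) = m"

definition crossing_edge_sets :: "nat \<Rightarrow> nat \<Rightarrow> (nat \<times> nat) set set set" where
  "crossing_edge_sets m n = path_edges ` {vs. left_right_crossing m n vs}"

definition maker_wins_crossing_game :: "nat \<Rightarrow> nat \<Rightarrow> nat \<Rightarrow> nat \<Rightarrow> bool" where
  "maker_wins_crossing_game p q m n \<longleftrightarrow>
     (\<exists>\<sigma>. maker_winning_strategy (grid_edges m n) (crossing_edge_sets m n) p q \<sigma>)"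

end

theory Submission
  imports Defs
begin

text \<open>
  Breaker wins iff his edges, seen in the dual graph, join the bottom of the board to its top.
  Give the dual vertices a potential \<open>\<phi>\<close> running from \<open>0\<close> at the bottom to
  \<open>N = q + 1\<close> at the top, and orient the dual edges upwards and rightwards. Contract every
  edge that Breaker claims and delete every edge that Maker claims. As long as the potential is
  well defined on the contracted graph, top and bottom have not been joined, and as long as it
  rises by at most \<open>1\<close> along each edge, one turn of Breaker cannot join them.

  Maker preserves the following: along each remaining edge \<open>\<phi>\<close> rises by \<open>0\<close> or \<open>1\<close>, and each
  contracted vertex has at most two incoming edges and at most two outgoing ones, of which at most
  one rises. When Breaker joins \<open>k + 1\<close> vertices by \<open>k\<close> edges, there remain at most \<open>k + 2\<close>
  incoming and \<open>k + 2\<close> outgoing edges. Maker lowers the merged vertex to its minimal potential and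
  deletes \<open>k\<close> edges of each kind; a count of the edges that rise too much shows that this suffices.
  A component containing the top is raised instead, for the same price. The orientation is
  asymmetric, so the vertices of potential \<open>N\<close> are exempt from the degree bounds, and edges leaving
  them may descend by \<open>1\<close>.

  On the full board, the edges across which the statement \<open>\<phi> = N\<close> changes all belong to Maker.
  They have even degree at every interior vertex and are odd in number in the first column, hence
  by parity the part reachable from the left side meets every column.
\<close>

section \<open>Contracting the edges claimed by Breaker\<close>

text \<open>Edges with both ends in one contracted vertex are no longer in \<open>F\<close>, even if unclaimed.\<close>

definition game_invariant ::
    "nat \<Rightarrow> 'e set \<Rightarrow> ('e \<Rightarrow> 'c) \<Rightarrow> ('e \<Rightarrow> 'c) \<Rightarrow> ('c \<Rightarrow> nat) \<Rightarrow> bool" where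
  "game_invariant N F t h \<phi> \<longleftrightarrow>
     (\<forall>c. \<phi> c \<le> N) \<and>
     (\<forall>e\<in>F. if \<phi> (t e) = N then N \<le> \<phi> (h e) + 1
            else \<phi> (t e) \<le> \<phi> (h e) \<and> \<phi> (h e) \<le> \<phi> (t e) + 1) \<and>
     (\<forall>c. \<phi> c < N \<longrightarrow>
        card {e\<in>F. t e = c} \<le> 2 \<and> card {e\<in>F. h e = c} \<le> 2 \<and>
        card {e\<in>F. t e = c \<and> \<phi> c < \<phi> (h e)} \<le> 1)"

lemma game_invariant_mono:
  assumes "game_invariant N F t h \<phi>" "F' \<subseteq> F" "finite F"
  shows "game_invariant N F' t h \<phi>"
proof -
  have c: "card {e\<in>F'. P e} \<le> card {e\<in>F. P e}" for P
    using assms(2,3) by (intro card_mono) auto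
  show ?thesis
    unfolding game_invariant_def
  proof (intro conjI allI impI; (intro order_trans[OF c])?)
    show "\<forall>e\<in>F'. if \<phi> (t e) = N then N \<le> \<phi> (h e) + 1
            else \<phi> (t e) \<le> \<phi> (h e) \<and> \<phi> (h e) \<le> \<phi> (t e) + 1"
      using assms(1,2) unfolding game_invariant_def by blast
  qed (use assms(1) in \<open>auto simp: game_invariant_def\<close>)
qed

section \<open>Counting and choosing finitely many edges\<close>

lemma card_fibres_le:
  assumes "finite A" "finite F" "\<And>c. c \<in> A \<Longrightarrow> card {e\<in>F. g e = c} \<le> k"
  shows "card {e\<in>F. g e \<in> A} \<le> k * card A"
proof -
  have "{e\<in>F. g e \<in> A} = (\<Union>c\<in>A. {e\<in>F. g e = c})" by auto
  then have "card {e\<in>F. g e \<in> A} \<le> (\<Sum>c\<in>A. card {e\<in>F. g e = c})"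
    using card_UN_le[OF assms(1)] by metis
  also have "\<dots> \<le> (\<Sum>c\<in>A. k)" by (rule sum_mono) (use assms in auto)
  finally show ?thesis by (simp add: mult.commute)
qed

text \<open>The compulsory elements \<open>A\<close> are taken first and the rest of the budget
  \<open>k\<close> is then spent on \<open>B\<close>. Truncated subtraction covers the case where
  the budget exhausts \<open>B\<close>.\<close>

lemma subset_between_card:
  assumes "A \<subseteq> B" "finite B" "card A \<le> k"
  obtains M where "A \<subseteq> M" "M \<subseteq> B" "card M \<le> k" "card (B - M) \<le> card B - k"
proof (cases "card B \<le> k")
  case True
  then show ?thesis using that[of B] assms by auto
next
  case False
  then obtain M where M: "A \<subseteq> M" "M \<subseteq> B" "card M = k"
    using exists_subset_between[of A k B] assms by auto
  then have "card (B - M) = card B - k"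
    using assms(2) by (metis card_Diff_subset finite_subset)
  then show ?thesis using that M by auto
qed

text \<open>A contracted set is represented by one of its own members. Hence \<open>\<phi>\<close>
  is the same function throughout the game: lowering or raising a merged vertex means choosing a
  representative \<open>c0\<close> of minimal potential or of potential \<open>N\<close>. The other
  members of \<open>C\<close> become isolated.\<close>

definition collapse :: "'c set \<Rightarrow> 'c \<Rightarrow> 'c \<Rightarrow> 'c" where
  "collapse C c0 c = (if c \<in> C then c0 else c)"

text \<open>\<open>C\<close> is a connected component of the graph whose edges are \<open>B\<close>.
  Connectedness is expressed by cuts, the form in which it is applied: once to grow a subset of
  \<open>C\<close>, once to the sets of vertices up to a given potential.\<close>

locale breaker_component =
  fixes N :: nat and F B :: "'e set" and t h :: "'e \<Rightarrow> 'c" and \<phi> :: "'c \<Rightarrow> nat" and C :: "'c set"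
  assumes finF: "finite F" and BF: "B \<subseteq> F" and inv: "game_invariant N F t h \<phi>"
    and finC: "finite C" and closed: "\<And>e. e \<in> B \<Longrightarrow> t e \<in> C \<longleftrightarrow> h e \<in> C"
    and connected: "\<And>S. S \<subseteq> C \<Longrightarrow> S \<noteq> {} \<Longrightarrow> S \<noteq> C \<Longrightarrow>
      \<exists>e\<in>B. t e \<in> S \<and> h e \<in> C - S \<or> h e \<in> S \<and> t e \<in> C - S"
begin

section \<open>Edge counts within one component\<close>

definition inner :: "'e set" where
  "inner = {e\<in>B. t e \<in> C}"

lemma inner_subset: "inner \<subseteq> F" and finite_inner: "finite inner"
  and inner_ends: "e \<in> inner \<Longrightarrow> t e \<in> C \<and> h e \<in> C"
  using BF finF closed by (auto simp: inner_def intro: finite_subset)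

text \<open>Grow \<open>S\<close> by one vertex at a time along an edge of Breaker leaving it.\<close>

lemma card_Diff_le_touching:
  assumes "S \<subseteq> C" "S \<noteq> {}"
  shows "card (C - S) \<le> card {e\<in>inner. t e \<notin> S \<or> h e \<notin> S}"
  using assms
proof (induction "card (C - S)" arbitrary: S)
  case (Suc k)
  then have "S \<noteq> C" by auto
  from connected[OF Suc.prems this] obtain e v where e: "e \<in> B" and v: "v \<in> C - S"
    and ev: "t e \<in> S \<and> h e = v \<or> h e \<in> S \<and> t e = v" by blast
  have ei: "e \<in> inner" using e ev v Suc.prems closed[OF e] by (auto simp: inner_def)
  let ?T = "insert v S"
  have CT: "C - ?T = (C - S) - {v}" by auto
  have "k = card (C - ?T)" using Suc.hyps(2) v finC by (simp add: CT)
  from Suc.hyps(1)[OF this] have IH: "card (C - ?T) \<le> card {e\<in>inner. t e \<notin> ?T \<or> h e \<notin> ?T}"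
    using v Suc.prems by auto
  have "Suc (card {e\<in>inner. t e \<notin> ?T \<or> h e \<notin> ?T}) = card (insert e {e\<in>inner. t e \<notin> ?T \<or> h e \<notin> ?T})"
    using ev finite_inner by (subst card_insert_disjoint) auto
  also have "\<dots> \<le> card {e\<in>inner. t e \<notin> S \<or> h e \<notin> S}"
    using ev ei v finite_inner by (intro card_mono) auto
  finally show ?case using IH Suc.hyps(2) \<open>k = card (C - ?T)\<close> by linarith
qed auto

lemma card_le_Suc_inner:
  assumes "C \<noteq> {}"
  shows "card C \<le> card inner + 1"
proof -
  obtain c where c: "c \<in> C" using assms by auto
  have "card (C - {c}) \<le> card {e\<in>inner. t e \<notin> {c} \<or> h e \<notin> {c}}"
    using c by (intro card_Diff_le_touching) auto
  also have "\<dots> \<le> card inner" using finite_inner by (intro card_mono) auto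
  finally show ?thesis using c finC by simp
qed

lemma phi_le: "\<phi> c \<le> N"
  and edge_top: "e \<in> F \<Longrightarrow> \<phi> (t e) = N \<Longrightarrow> N \<le> \<phi> (h e) + 1"
  and edge_mono: "e \<in> F \<Longrightarrow> \<phi> (t e) < N \<Longrightarrow> \<phi> (t e) \<le> \<phi> (h e)"
  and edge_step: "e \<in> F \<Longrightarrow> \<phi> (h e) \<le> \<phi> (t e) + 1"
  and out_le: "\<phi> c < N \<Longrightarrow> card {e\<in>F. t e = c} \<le> 2"
  and in_le: "\<phi> c < N \<Longrightarrow> card {e\<in>F. h e = c} \<le> 2"
  and steep_le: "\<phi> c < N \<Longrightarrow> card {e\<in>F. t e = c \<and> \<phi> c < \<phi> (h e)} \<le> 1"
  using inv unfolding game_invariant_def by (auto split: if_splits simp: le_Suc_eq)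

lemma card_out_le:
  assumes "A \<subseteq> C" "\<And>c. c \<in> A \<Longrightarrow> \<phi> c < N"
  shows "card {e\<in>F. t e \<in> A} \<le> 2 * card A"
  using assms finC finF by (intro card_fibres_le out_le) (auto intro: finite_subset)

lemma card_in_le:
  assumes "A \<subseteq> C" "\<And>c. c \<in> A \<Longrightarrow> \<phi> c < N"
  shows "card {e\<in>F. h e \<in> A} \<le> 2 * card A"
  using assms finC finF by (intro card_fibres_le in_le) (auto intro: finite_subset)

lemma card_steep_le:
  assumes "A \<subseteq> C" "\<And>c. c \<in> A \<Longrightarrow> \<phi> c < N"
  shows "card {e\<in>F. t e \<in> A \<and> \<phi> (t e) < \<phi> (h e)} \<le> card A"
proof -
  have "card {e\<in>{e\<in>F. \<phi> (t e) < \<phi> (h e)}. t e \<in> A} \<le> 1 * card A"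
  proof (rule card_fibres_le)
    fix c assume "c \<in> A"
    have "{e\<in>{e\<in>F. \<phi> (t e) < \<phi> (h e)}. t e = c} = {e\<in>F. t e = c \<and> \<phi> c < \<phi> (h e)}" by auto
    then show "card {e\<in>{e\<in>F. \<phi> (t e) < \<phi> (h e)}. t e = c} \<le> 1"
      using steep_le assms(2)[OF \<open>c \<in> A\<close>] by metis
  qed (use assms finC finF finite_subset in auto)
  also have "{e\<in>{e\<in>F. \<phi> (t e) < \<phi> (h e)}. t e \<in> A} = {e\<in>F. t e \<in> A \<and> \<phi> (t e) < \<phi> (h e)}"
    by auto
  finally show ?thesis by simp
qed

text \<open>The common pattern of the counts below: degree bounds control \<open>X\<close>, and each
  inner edge found in \<open>X\<close> leaves room for one fewer edge \<open>Y\<close> between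
  \<open>C\<close> and its complement.\<close>

lemma card_outer_le:
  assumes "X \<subseteq> F" "J \<subseteq> X" "J \<subseteq> inner" "Y \<subseteq> X - inner"
  shows "card Y + card J \<le> card X"
proof -
  have "finite X" using assms(1) finF by (rule finite_subset)
  moreover from this have "finite Y" "finite J"
    using assms finite_subset[of Y X] finite_subset[of J X] by auto
  moreover have "Y \<inter> J = {}" using assms by auto
  ultimately have "card Y + card J = card (Y \<union> J)" by (simp add: card_Un_disjoint)
  also have "\<dots> \<le> card X" using assms \<open>finite X\<close> by (intro card_mono) auto
  finally show ?thesis .
qed

text \<open>With \<open>k\<close> inner edges there are at most \<open>k + 1\<close> vertices of
  degree at most 2 each way, so at most \<open>k + 2\<close> edges leave \<open>C\<close> and as
  many enter it. After dropping to the minimum \<open>\<mu>\<close>, the edges leaving for potential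
  \<open>\<mu> + 2\<close> or more (\<open>X2\<close>) must go, at most one leaving for more than
  \<open>\<mu>\<close> (\<open>X1\<close>) may stay, and the edges \<open>Y1\<close> entering from
  above must go. Each demand fits into \<open>k\<close> deletions among the leaving and
  \<open>k\<close> among the entering edges.\<close>

lemma lower_component:
  assumes low: "\<And>c. c \<in> C \<Longrightarrow> \<phi> c < N" and "C \<noteq> {}"
  obtains Y c0 where "c0 \<in> C" "\<And>c. c \<in> C \<Longrightarrow> \<phi> c0 \<le> \<phi> c"
    "Y \<subseteq> {e\<in>F. (t e \<in> C) \<noteq> (h e \<in> C)}" "card Y \<le> 2 * card inner"
    "game_invariant N {e\<in>F - Y. \<not> (t e \<in> C \<and> h e \<in> C)}
       (collapse C c0 \<circ> t) (collapse C c0 \<circ> h) \<phi>"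
proof -
  define k where "k = card inner"
  obtain c0 where c0: "c0 \<in> C" and min: "\<And>c. c \<in> C \<Longrightarrow> \<phi> c0 \<le> \<phi> c"
    using arg_min_if_finite[OF finC \<open>C \<noteq> {}\<close>, of \<phi>] not_less by blast
  define \<mu> where "\<mu> = \<phi> c0"
  have \<mu>N: "\<mu> < N" using low c0 by (auto simp: \<mu>_def)
  have Ck: "card C \<le> k + 1" using card_le_Suc_inner \<open>C \<noteq> {}\<close> by (simp add: k_def)
  define C0 where "C0 = {c\<in>C. \<phi> c = \<mu>}"
  define C01 where "C01 = {c\<in>C. \<phi> c \<le> \<mu> + 1}"
  define Out where "Out = {e\<in>F. t e \<in> C \<and> h e \<notin> C}"
  define In where "In = {e\<in>F. t e \<notin> C \<and> h e \<in> C}"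
  define X1 where "X1 = {e\<in>Out. \<mu> + 1 \<le> \<phi> (h e)}"
  define X2 where "X2 = {e\<in>Out. \<mu> + 2 \<le> \<phi> (h e)}"
  \<comment> \<open>Entering edges from above \<open>\<mu>\<close> would descend. The exception is a
    tail at the top, from which a descent by 1 is allowed.\<close>
  define Y1 where "Y1 = {e\<in>In. \<mu> < \<phi> (t e) \<and> \<not> (\<phi> (t e) = N \<and> N \<le> \<mu> + 1)}"
  have disj: "Out \<inter> inner = {}" "In \<inter> inner = {}"
    using inner_ends by (auto simp: Out_def In_def)
  have fin: "finite Out" "finite In" using finF by (auto simp: Out_def In_def)
  have C0: "C0 \<subseteq> C" "C0 \<noteq> {}" "finite C0" "C0 \<subseteq> C01" using c0 finC by (auto simp: C0_def C01_def \<mu>_def)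
  have C01: "C01 \<subseteq> C" "C01 \<noteq> {}" using C0 by (auto simp: C01_def)
  have cC0: "card (C - C0) + card C0 = card C"
    using C0 finC by (metis card_Diff_subset card_mono le_add_diff_inverse2)
  have cC01: "card (C - C01) + card (C01 - C0) + card C0 = card C"
  proof -
    have "C - C0 = (C - C01) \<union> (C01 - C0)" "(C - C01) \<inter> (C01 - C0) = {}"
      using C0 C01 by auto
    then have "card (C - C0) = card (C - C01) + card (C01 - C0)"
      using finC C01 by (metis card_Un_disjoint finite_Diff finite_subset)
    then show ?thesis using cC0 by simp
  qed
  have C0pos: "card C0 \<ge> 1" using C0 by (simp add: Suc_leI card_gt_0_iff)
  have mono: "\<phi> (t e) \<le> \<phi> (h e)" if "e \<in> inner" for e
    using that inner_ends inner_subset low edge_mono by blast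
  have out0: "card Out \<le> k + 2"
  proof -
    have "card Out + card inner \<le> card {e\<in>F. t e \<in> C}"
      using disj inner_subset inner_ends by (intro card_outer_le) (auto simp: Out_def)
    also have "\<dots> \<le> 2 * card C" by (intro card_out_le) (use low in auto)
    finally show ?thesis using Ck by (simp add: k_def)
  qed
  have in0: "card In \<le> k + 2"
  proof -
    have "card In + card inner \<le> card {e\<in>F. h e \<in> C}"
      using disj inner_subset inner_ends by (intro card_outer_le) (auto simp: In_def)
    also have "\<dots> \<le> 2 * card C" by (intro card_in_le) (use low in auto)
    finally show ?thesis using Ck by (simp add: k_def)
  qed
  have touch0: "card (C - C0) \<le> card {e\<in>inner. t e \<notin> C0 \<or> h e \<notin> C0}"
    using C0 by (intro card_Diff_le_touching)
  have touch1: "card (C - C01) \<le> card {e\<in>inner. t e \<notin> C01 \<or> h e \<notin> C01}"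
    using C01 by (intro card_Diff_le_touching)
  have above0: "\<mu> + 1 \<le> \<phi> (h e)" if "e \<in> inner" "t e \<notin> C0 \<or> h e \<notin> C0" for e
    using that inner_ends[OF that(1)] mono[OF that(1)] min[of "t e"] min[of "h e"]
    by (auto simp: C0_def \<mu>_def)
  have above1: "\<mu> + 2 \<le> \<phi> (h e)" if "e \<in> inner" "t e \<notin> C01 \<or> h e \<notin> C01" for e
    using that inner_ends[OF that(1)] mono[OF that(1)] by (auto simp: C01_def)
  \<comment> \<open>The edges \<open>Y1\<close> and the inner edges touching \<open>C - C0\<close>
    all have heads in \<open>C - C0\<close>. There are at most two edges into each such vertex, and
    at least \<open>card (C - C0)\<close> of them are inner; as \<open>C0\<close> is nonempty, at
    most \<open>k\<close> are left.\<close>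
  have in1: "card Y1 \<le> k"
  proof -
    have hd: "h e \<in> C - C0" if "e \<in> Y1" for e
    proof -
      have e: "e \<in> F" "h e \<in> C" "\<mu> < \<phi> (t e)" "\<not> (\<phi> (t e) = N \<and> N \<le> \<mu> + 1)"
        using that by (auto simp: Y1_def In_def)
      have "\<phi> (h e) > \<mu>"
      proof (cases "\<phi> (t e) = N")
        case True then show ?thesis using edge_top[OF e(1)] e(4) by auto
      next
        case False
        then have "\<phi> (t e) < N" using phi_le[of "t e"] by auto
        then show ?thesis using edge_mono[OF e(1)] e(3) by auto
      qed
      then show ?thesis using e by (auto simp: C0_def)
    qed
    have J: "h e \<in> C - C0" if "e \<in> inner" "t e \<notin> C0 \<or> h e \<notin> C0" for e
      using above0[OF that] inner_ends[OF that(1)] by (auto simp: C0_def)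
    have "card Y1 + card {e\<in>inner. t e \<notin> C0 \<or> h e \<notin> C0} \<le> card {e\<in>F. h e \<in> C - C0}"
    proof (intro card_outer_le)
      show "Y1 \<subseteq> {e\<in>F. h e \<in> C - C0} - inner"
        using hd disj by (auto simp: Y1_def In_def)
    qed (use J inner_subset in auto)
    also have "\<dots> \<le> 2 * card (C - C0)" by (intro card_in_le) (use low in auto)
    finally show ?thesis using touch0 cC0 C0pos Ck by linarith
  qed
  \<comment> \<open>A tail in \<open>C0\<close> counts once, because its edge has to rise, and any
    other tail counts twice. The inner edges touching \<open>C - C0\<close> absorb one edge per
    vertex of \<open>C - C0\<close>, which leaves at most \<open>card C\<close>.\<close>
  have out1: "card X1 \<le> k + 1"
  proof -
    let ?E = "{e\<in>F. t e \<in> C \<and> \<mu> + 1 \<le> \<phi> (h e)}"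
    have "card X1 + card {e\<in>inner. t e \<notin> C0 \<or> h e \<notin> C0} \<le> card ?E"
      using disj inner_subset inner_ends above0
      by (intro card_outer_le) (auto simp: X1_def Out_def)
    also have "\<dots> \<le> card ({e\<in>F. t e \<in> C0 \<and> \<phi> (t e) < \<phi> (h e)} \<union> {e\<in>F. t e \<in> C - C0})"
      using finF by (intro card_mono) (auto simp: C0_def)
    also have "\<dots> \<le> card C0 + 2 * card (C - C0)"
      by (intro order_trans[OF card_Un_le] add_mono card_steep_le card_out_le) (use low C0 in auto)
    finally show ?thesis using touch0 cC0 Ck by linarith
  qed
  \<comment> \<open>The same count one level higher: tails in \<open>C0\<close> cannot reach
    \<open>\<mu> + 2\<close> in one step, so the bound improves by \<open>card C0\<close>, which is
    at least 1.\<close>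
  have out2: "card X2 \<le> k"
  proof -
    let ?E = "{e\<in>F. t e \<in> C \<and> \<mu> + 2 \<le> \<phi> (h e)}"
    have "card X2 + card {e\<in>inner. t e \<notin> C01 \<or> h e \<notin> C01} \<le> card ?E"
      using disj inner_subset inner_ends above1
      by (intro card_outer_le) (auto simp: X2_def Out_def)
    also have "\<dots> \<le> card ({e\<in>F. t e \<in> C01 - C0 \<and> \<phi> (t e) < \<phi> (h e)} \<union> {e\<in>F. t e \<in> C - C01})"
    proof (intro card_mono subsetI)
      fix e assume "e \<in> ?E"
      then show "e \<in> {e\<in>F. t e \<in> C01 - C0 \<and> \<phi> (t e) < \<phi> (h e)} \<union> {e\<in>F. t e \<in> C - C01}"
        using edge_step[of e] min[of "t e"] by (auto simp: C01_def C0_def \<mu>_def)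
    qed (use finF in auto)
    also have "\<dots> \<le> card (C01 - C0) + 2 * card (C - C01)"
      by (intro order_trans[OF card_Un_le] add_mono card_steep_le card_out_le) (use low C01 in auto)
    finally show ?thesis using touch1 cC01 C0pos Ck by linarith
  qed
  \<comment> \<open>As \<open>X2\<close> lies in \<open>X1\<close> and \<open>X1\<close> in
    \<open>Out\<close>, nested choices let the same \<open>k\<close> deletions meet all three
    demands on leaving edges.\<close>
  obtain M1 where M1: "X2 \<subseteq> M1" "M1 \<subseteq> X1" "card M1 \<le> k" "card (X1 - M1) \<le> card X1 - k"
  proof (rule subset_between_card[of X2 X1 k])
    show "X2 \<subseteq> X1" by (auto simp: X1_def X2_def)
    show "finite X1" using fin by (simp add: X1_def)
  qed (use out2 in auto)
  obtain M where M: "M1 \<subseteq> M" "M \<subseteq> Out" "card M \<le> k" "card (Out - M) \<le> card Out - k"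
  proof (rule subset_between_card[of M1 Out k])
    show "M1 \<subseteq> Out" using M1 by (auto simp: X1_def)
  qed (use M1 fin in auto)
  obtain L where L: "Y1 \<subseteq> L" "L \<subseteq> In" "card L \<le> k" "card (In - L) \<le> card In - k"
  proof (rule subset_between_card[of Y1 In k])
    show "Y1 \<subseteq> In" by (auto simp: Y1_def)
  qed (use in1 fin in auto)
  let ?F = "{e\<in>F - (M \<union> L). \<not> (t e \<in> C \<and> h e \<in> C)}"
  have eF: "e \<in> F \<and> \<not> (t e \<in> C \<and> h e \<in> C) \<and> (t e \<in> C \<longrightarrow> \<phi> (h e) \<le> \<mu> + 1) \<and>
     (h e \<in> C \<longrightarrow> \<phi> (t e) \<le> \<mu> \<or> \<phi> (t e) = N \<and> N \<le> \<mu> + 1)" if "e \<in> ?F" for e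
  proof -
    have "e \<notin> X2" "e \<notin> Y1" using that M1 M L by blast+
    then show ?thesis using that by (auto simp: Out_def In_def X2_def Y1_def)
  qed
  show ?thesis
  proof (rule that[of c0 "M \<union> L"])
    show "M \<union> L \<subseteq> {e\<in>F. (t e \<in> C) \<noteq> (h e \<in> C)}"
      using M L by (auto simp: Out_def In_def)
    show "card (M \<union> L) \<le> 2 * card inner"
      using card_Un_le[of M L] M L by (simp add: k_def)
    show "game_invariant N ?F (collapse C c0 \<circ> t) (collapse C c0 \<circ> h) \<phi>"
      unfolding game_invariant_def
    proof (intro conjI allI ballI impI phi_le)
      fix e assume e: "e \<in> ?F"
      note eF = eF[OF e]
      show "if \<phi> ((collapse C c0 \<circ> t) e) = N then N \<le> \<phi> ((collapse C c0 \<circ> h) e) + 1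
        else \<phi> ((collapse C c0 \<circ> t) e) \<le> \<phi> ((collapse C c0 \<circ> h) e) \<and>
             \<phi> ((collapse C c0 \<circ> h) e) \<le> \<phi> ((collapse C c0 \<circ> t) e) + 1"
      proof (cases "t e \<in> C")
        case True
        then have "\<phi> (t e) \<le> \<phi> (h e)" using low edge_mono eF by blast
        then show ?thesis using True eF min[OF True] low[OF c0] by (auto simp: collapse_def \<mu>_def)
      next
        case False
        note tC = this
        show ?thesis
        proof (cases "h e \<in> C")
          case True
          then show ?thesis using False eF min[OF True] \<mu>N edge_step[of e]
            by (auto simp: collapse_def \<mu>_def)
        next
          case False
          then show ?thesis using tC eF edge_top[of e] edge_mono[of e] edge_step[of e] phi_le[of "t e"]
            by (auto simp: collapse_def)
        qed
      qed
    next
      fix c assume c: "\<phi> c < N"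
      have "card {e\<in>?F. (collapse C c0 \<circ> t) e = c} \<le> 2 \<and>
        card {e\<in>?F. (collapse C c0 \<circ> h) e = c} \<le> 2 \<and>
        card {e\<in>?F. (collapse C c0 \<circ> t) e = c \<and> \<phi> c < \<phi> ((collapse C c0 \<circ> h) e)} \<le> 1"
      proof (cases "c \<in> C")
        case True
        have "{e\<in>?F. (collapse C c0 \<circ> t) e = c} \<subseteq> Out - M"
          using True c0 by (auto simp: collapse_def Out_def split: if_splits)
        then have "card {e\<in>?F. (collapse C c0 \<circ> t) e = c} \<le> card (Out - M)"
          using fin by (intro card_mono) auto
        moreover have "{e\<in>?F. (collapse C c0 \<circ> h) e = c} \<subseteq> In - L"
          using True c0 by (auto simp: collapse_def In_def split: if_splits)
        then have "card {e\<in>?F. (collapse C c0 \<circ> h) e = c} \<le> card (In - L)"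
          using fin by (intro card_mono) auto
        moreover have "{e\<in>?F. (collapse C c0 \<circ> t) e = c \<and> \<phi> c < \<phi> ((collapse C c0 \<circ> h) e)} \<subseteq> X1 - M1"
          using True c0 M min[OF True] by (auto simp: collapse_def Out_def X1_def \<mu>_def split: if_splits)
        then have "card {e\<in>?F. (collapse C c0 \<circ> t) e = c \<and> \<phi> c < \<phi> ((collapse C c0 \<circ> h) e)} \<le> card (X1 - M1)"
          using fin by (intro card_mono) (auto simp: X1_def)
        ultimately show ?thesis using M L M1 out0 out1 in0 by linarith
      next
        case False
        have cc: "collapse C c0 d = c \<longleftrightarrow> d = c" for d
          using False c0 by (auto simp: collapse_def)
        \<comment> \<open>Merging only lowers heads, so no edge from a vertex outside
          \<open>C\<close> starts to rise.\<close>
        have le: "\<phi> (collapse C c0 d) \<le> \<phi> d" for d using min by (auto simp: collapse_def)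
        have *: "card {e\<in>?F. (collapse C c0 \<circ> t) e = c} \<le> card {e\<in>F. t e = c}"
          using finF by (intro card_mono) (auto simp: cc)
        have **: "card {e\<in>?F. (collapse C c0 \<circ> h) e = c} \<le> card {e\<in>F. h e = c}"
          using finF by (intro card_mono) (auto simp: cc)
        have "card {e\<in>?F. (collapse C c0 \<circ> t) e = c \<and> \<phi> c < \<phi> ((collapse C c0 \<circ> h) e)}
            \<le> card {e\<in>F. t e = c \<and> \<phi> c < \<phi> (h e)}"
          using finF by (intro card_mono) (auto simp: cc intro: less_le_trans[OF _ le])
        then show ?thesis using * ** out_le[OF c] in_le[OF c] steep_le[OF c] by linarith
      qed
      then show "card {e\<in>?F. (collapse C c0 \<circ> t) e = c} \<le> 2"
        "card {e\<in>?F. (collapse C c0 \<circ> h) e = c} \<le> 2"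
        "card {e\<in>?F. (collapse C c0 \<circ> t) e = c \<and> \<phi> c < \<phi> ((collapse C c0 \<circ> h) e)} \<le> 1"
        by auto
    qed
  qed (use c0 min in auto)
qed

text \<open>At potential \<open>N\<close> the merged vertex is exempt from degree bounds. Only edges
  entering vertices of \<open>C\<close> that get raised, and edges leaving \<open>C\<close> for
  potential below \<open>N - 1\<close>, have to go. The inner edges touching \<open>Low\<close> are
  subtracted in both counts; there are at least \<open>card Low\<close> of them, so the total is at
  most \<open>2 * card (C - T)\<close>.\<close>

lemma raise_component:
  assumes c0: "c0 \<in> C" and top: "\<phi> c0 = N"
  obtains Y where "Y \<subseteq> {e\<in>F. (t e \<in> C) \<noteq> (h e \<in> C)}" "card Y \<le> 2 * card inner"
    "game_invariant N {e\<in>F - Y. \<not> (t e \<in> C \<and> h e \<in> C)}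
       (collapse C c0 \<circ> t) (collapse C c0 \<circ> h) \<phi>"
proof -
  define T where "T = {c\<in>C. \<phi> c = N}"
  define Low where "Low = {c\<in>C. \<phi> c + 2 \<le> N}"
  define In where "In = {e\<in>F. t e \<notin> C \<and> h e \<in> C - T}"
  define Out where "Out = {e\<in>F. t e \<in> Low \<and> h e \<notin> C \<and> \<phi> (h e) + 2 \<le> N}"
  have T: "T \<subseteq> C" "T \<noteq> {}" using c0 top by (auto simp: T_def)
  have nT: "\<phi> c < N" if "c \<in> C - T" for c using that phi_le[of c] by (auto simp: T_def)
  let ?J = "{e\<in>inner. t e \<notin> C - Low \<or> h e \<notin> C - Low}"
  have "card (C - (C - Low)) \<le> card ?J"
    using T by (intro card_Diff_le_touching) (auto simp: T_def Low_def)
  also have "C - (C - Low) = Low" by (auto simp: Low_def)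
  finally have J: "card Low \<le> card ?J" .
  \<comment> \<open>A tail at \<open>N - 1\<close> or \<open>N\<close> forces the head to be at
    least \<open>N - 1\<close>, so an edge touching \<open>Low\<close> starts in \<open>Low\<close>;
    it then rises by at most 1 and stays below \<open>N\<close>.\<close>
  have tail_low: "t e \<in> Low" and head_low: "h e \<in> C - T" if "e \<in> ?J" for e
  proof -
    have e: "e \<in> F" "t e \<in> C" "h e \<in> C" using that inner_subset inner_ends by auto
    have *: "\<phi> (t e) + 2 \<le> N \<or> \<phi> (h e) + 2 \<le> N" using that e by (auto simp: Low_def)
    have **: "\<phi> (t e) + 2 \<le> N"
    proof (cases "\<phi> (t e) = N")
      case True then show ?thesis using * edge_top[OF e(1)] by auto
    next
      case False
      then have "\<phi> (t e) < N" using phi_le[of "t e"] by auto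
      then show ?thesis using * edge_mono[OF e(1)] by auto
    qed
    then show "t e \<in> Low" using e by (auto simp: Low_def)
    show "h e \<in> C - T" using e ** edge_step[OF e(1)] by (auto simp: T_def)
  qed
  have "card In + card ?J \<le> card {e\<in>F. h e \<in> C - T}"
    using inner_subset inner_ends head_low by (intro card_outer_le) (auto simp: In_def)
  also have "\<dots> \<le> 2 * card (C - T)" by (intro card_in_le nT) auto
  finally have cIn: "card In + card ?J \<le> 2 * card (C - T)" .
  have "card Out + card ?J \<le> card {e\<in>F. t e \<in> Low}"
    using inner_subset inner_ends tail_low by (intro card_outer_le) (auto simp: Out_def)
  also have "\<dots> \<le> 2 * card Low" by (intro card_out_le) (auto simp: Low_def)
  finally have cOut: "card Out + card ?J \<le> 2 * card Low" .
  have "card (C - T) \<le> card {e\<in>inner. t e \<notin> T \<or> h e \<notin> T}"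
    using T by (intro card_Diff_le_touching)
  also have "\<dots> \<le> card inner" using finite_inner by (intro card_mono) auto
  finally have cC: "card (C - T) \<le> card inner" .
  let ?F = "{e\<in>F - (In \<union> Out). \<not> (t e \<in> C \<and> h e \<in> C)}"
  have hT: "\<phi> (h e) = N" if "e \<in> ?F" "h e \<in> C" for e
    using that by (auto simp: In_def T_def)
  have tT: "N \<le> \<phi> (h e) + 1" if "e \<in> ?F" "t e \<in> C" for e
  proof (cases "t e \<in> Low")
    case True then show ?thesis using that by (auto simp: Out_def)
  next
    case False
    then have "N \<le> \<phi> (t e) + 1" using that by (auto simp: Low_def)
    then show ?thesis using that edge_top[of e] edge_mono[of e] phi_le[of "t e"] by fastforce
  qed
  show ?thesis
  proof (rule that[of "In \<union> Out"])
    show "In \<union> Out \<subseteq> {e\<in>F. (t e \<in> C) \<noteq> (h e \<in> C)}"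
      by (auto simp: Out_def In_def Low_def)
    show "card (In \<union> Out) \<le> 2 * card inner"
      using card_Un_le[of In Out] cIn cOut cC J by linarith
    show "game_invariant N ?F (collapse C c0 \<circ> t) (collapse C c0 \<circ> h) \<phi>"
      unfolding game_invariant_def
    proof (intro conjI allI ballI impI phi_le)
      fix e assume e: "e \<in> ?F"
      then have "e \<in> F" by auto
      have h: "\<phi> (collapse C c0 (h e)) = \<phi> (h e)" using hT[OF e] top by (auto simp: collapse_def)
      show "if \<phi> ((collapse C c0 \<circ> t) e) = N then N \<le> \<phi> ((collapse C c0 \<circ> h) e) + 1
        else \<phi> ((collapse C c0 \<circ> t) e) \<le> \<phi> ((collapse C c0 \<circ> h) e) \<and>
             \<phi> ((collapse C c0 \<circ> h) e) \<le> \<phi> ((collapse C c0 \<circ> t) e) + 1"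
      proof (cases "t e \<in> C")
        case True
        then show ?thesis using tT[OF e True] top h by (auto simp: collapse_def)
      next
        case False
        then have "collapse C c0 (t e) = t e" by (simp add: collapse_def)
        then show ?thesis
          using h edge_top[OF \<open>e \<in> F\<close>] edge_mono[OF \<open>e \<in> F\<close>] edge_step[OF \<open>e \<in> F\<close>] phi_le[of "t e"]
          by auto
      qed
    next
      fix c assume c: "\<phi> c < N"
      then have "c \<noteq> c0" using top by auto
      then have cc: "collapse C c0 d = c \<Longrightarrow> d = c" for d by (auto simp: collapse_def split: if_splits)
      have "card {e\<in>?F. (collapse C c0 \<circ> t) e = c} \<le> card {e\<in>F. t e = c}"
        using cc finF by (intro card_mono) auto
      then show "card {e\<in>?F. (collapse C c0 \<circ> t) e = c} \<le> 2" using out_le[OF c] by linarith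
      have "card {e\<in>?F. (collapse C c0 \<circ> h) e = c} \<le> card {e\<in>F. h e = c}"
        using cc finF by (intro card_mono) auto
      then show "card {e\<in>?F. (collapse C c0 \<circ> h) e = c} \<le> 2" using in_le[OF c] by linarith
      have "{e\<in>?F. (collapse C c0 \<circ> t) e = c \<and> \<phi> c < \<phi> ((collapse C c0 \<circ> h) e)}
          \<subseteq> {e\<in>F. t e = c \<and> \<phi> c < \<phi> (h e)}"
      proof
        fix e assume e: "e \<in> {e\<in>?F. (collapse C c0 \<circ> t) e = c \<and> \<phi> c < \<phi> ((collapse C c0 \<circ> h) e)}"
        then have "\<phi> (collapse C c0 (h e)) = \<phi> (h e)" using hT[of e] top by (auto simp: collapse_def)
        then show "e \<in> {e\<in>F. t e = c \<and> \<phi> c < \<phi> (h e)}" using e cc by auto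
      qed
      then have "card {e\<in>?F. (collapse C c0 \<circ> t) e = c \<and> \<phi> c < \<phi> ((collapse C c0 \<circ> h) e)}
          \<le> card {e\<in>F. t e = c \<and> \<phi> c < \<phi> (h e)}"
        using finF by (intro card_mono) auto
      then show "card {e\<in>?F. (collapse C c0 \<circ> t) e = c \<and> \<phi> c < \<phi> ((collapse C c0 \<circ> h) e)} \<le> 1"
        using steep_le[OF c] by linarith
    qed
  qed
qed

text \<open>A discrete intermediate value argument: for each \<open>j < N\<close> some inner edge
  crosses from potential at most \<open>j\<close> to more than \<open>j\<close>, and its lower end
  is exactly at \<open>j\<close>. Distinct levels therefore give distinct edges.\<close>

lemma card_inner_ge_height:
  assumes "a \<in> C" "\<phi> a = 0" "b \<in> C" "\<phi> b = N"
  shows "N \<le> card inner"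
proof -
  let ?lev = "\<lambda>e. min (\<phi> (t e)) (\<phi> (h e))"
  have "{..<N} \<subseteq> ?lev ` inner"
  proof
    fix j assume "j \<in> {..<N}"
    then have j: "j < N" by simp
    let ?S = "{c\<in>C. \<phi> c \<le> j}"
    have "a \<in> ?S" "b \<notin> ?S" using assms j by auto
    then have "?S \<noteq> {}" "?S \<noteq> C" using assms by blast+
    then obtain e where e: "e \<in> B"
      and "t e \<in> ?S \<and> h e \<in> C - ?S \<or> h e \<in> ?S \<and> t e \<in> C - ?S"
      using connected[of ?S] by blast
    then have *: "e \<in> inner" "\<phi> (t e) \<le> j \<and> j < \<phi> (h e) \<or> \<phi> (h e) \<le> j \<and> j < \<phi> (t e)"
      by (auto simp: inner_def)
    then have eF: "e \<in> F" using inner_subset by auto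
    have "?lev e = j"
      using *(2) j edge_top[OF eF] edge_mono[OF eF] edge_step[OF eF] phi_le[of "t e"] phi_le[of "h e"]
      by (cases "\<phi> (t e) = N") (auto simp: min_def)
    then show "j \<in> ?lev ` inner" using * by blast
  qed
  then have "card {..<N} \<le> card (?lev ` inner)" using finite_inner by (intro card_mono) auto
  also have "\<dots> \<le> card inner" using finite_inner by (rule card_image_le)
  finally show ?thesis by simp
qed

text \<open>A component with fewer than \<open>N\<close> inner edges cannot meet both potential 0
  and potential \<open>N\<close>. So raising moves no vertex of potential 0, and lowering is used
  only when no vertex of potential \<open>N\<close> is involved.\<close>

lemma contract_component:
  assumes "C \<noteq> {}" "card inner < N"
  obtains Y c0 where "c0 \<in> C" "Y \<subseteq> {e\<in>F. (t e \<in> C) \<noteq> (h e \<in> C)}" "card Y \<le> 2 * card inner"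
    "game_invariant N {e\<in>F - Y. \<not> (t e \<in> C \<and> h e \<in> C)}
       (collapse C c0 \<circ> t) (collapse C c0 \<circ> h) \<phi>"
    "\<And>c. \<phi> c = 0 \<Longrightarrow> \<phi> (collapse C c0 c) = 0" "\<And>c. \<phi> c = N \<Longrightarrow> \<phi> (collapse C c0 c) = N"
proof (cases "\<exists>c\<in>C. \<phi> c = N")
  case True
  then obtain c0 where c0: "c0 \<in> C" "\<phi> c0 = N" by auto
  then have "\<phi> c \<noteq> 0" if "c \<in> C" for c using card_inner_ge_height that assms(2) by fastforce
  then have "c \<notin> C" if "\<phi> c = 0" for c using that by blast
  then have zero: "\<phi> (collapse C c0 c) = 0" if "\<phi> c = 0" for c
    using that by (simp add: collapse_def)
  have top: "\<phi> (collapse C c0 c) = N" if "\<phi> c = N" for c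
    using that c0 by (auto simp: collapse_def)
  obtain Y where "Y \<subseteq> {e\<in>F. (t e \<in> C) \<noteq> (h e \<in> C)}" "card Y \<le> 2 * card inner"
    "game_invariant N {e\<in>F - Y. \<not> (t e \<in> C \<and> h e \<in> C)}
       (collapse C c0 \<circ> t) (collapse C c0 \<circ> h) \<phi>"
    by (rule raise_component[OF c0])
  then show ?thesis by (rule that[OF c0(1) _ _ _ zero top])
next
  case False
  then have low: "\<phi> c < N" if "c \<in> C" for c
    using that phi_le[of c] le_neq_implies_less by blast
  obtain Y c0 where *: "c0 \<in> C" "\<And>c. c \<in> C \<Longrightarrow> \<phi> c0 \<le> \<phi> c"
    "Y \<subseteq> {e\<in>F. (t e \<in> C) \<noteq> (h e \<in> C)}" "card Y \<le> 2 * card inner"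
    "game_invariant N {e\<in>F - Y. \<not> (t e \<in> C \<and> h e \<in> C)}
       (collapse C c0 \<circ> t) (collapse C c0 \<circ> h) \<phi>"
    by - (rule lower_component; assumption?; (rule low assms(1) that; assumption?))
  show ?thesis
  proof (rule that[OF *(1,3,4,5)])
    show "\<phi> (collapse C c0 c) = 0" if "\<phi> c = 0" for c
      using that *(2)[of c] by (auto simp: collapse_def)
    show "\<phi> (collapse C c0 c) = N" if "\<phi> c = N" for c
      using that False by (auto simp: collapse_def)
  qed
qed

end

text \<open>\<open>C\<close> is the least set containing \<open>v\<close> that no edge of
  \<open>B\<close> leaves or enters. If no edge of \<open>B\<close> joined \<open>S\<close> to
  \<open>C - S\<close>, whichever part contains \<open>v\<close> would be a smaller such
  set.\<close>

lemma component_exists: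
  assumes "finite B" "finite F" "B \<subseteq> F" "game_invariant N F t h \<phi>"
  obtains C where "v \<in> C" "breaker_component N F B t h \<phi> C"
proof -
  define cl where "cl = (\<lambda>S. \<forall>e\<in>B. t e \<in> S \<longleftrightarrow> h e \<in> S)"
  define C where "C = \<Inter> {S. v \<in> S \<and> cl S}"
  let ?U = "insert v (t ` B \<union> h ` B)"
  have "cl ?U" by (auto simp: cl_def)
  then have "C \<subseteq> ?U" by (auto simp: C_def)
  then have fin: "finite C" using assms(1) finite_subset by blast
  have v: "v \<in> C" by (auto simp: C_def)
  have clC: "cl C" by (auto simp: C_def cl_def)
  have min: "C \<subseteq> S" if "v \<in> S" "cl S" for S using that by (auto simp: C_def)
  have "breaker_component N F B t h \<phi> C"
  proof (unfold_locales, fact, fact, fact, fact)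
    show "(t e \<in> C) = (h e \<in> C)" if "e \<in> B" for e using clC that by (auto simp: cl_def)
    fix S assume S: "S \<subseteq> C" "S \<noteq> {}" "S \<noteq> C"
    show "\<exists>e\<in>B. t e \<in> S \<and> h e \<in> C - S \<or> h e \<in> S \<and> t e \<in> C - S"
    proof (rule ccontr)
      assume "\<not> ?thesis"
      then have "cl S" "cl (C - S)" using clC S(1) by (auto simp: cl_def)
      then show False using min[of S] min[of "C - S"] v S by blast
    qed
  qed
  then show ?thesis using that v by blast
qed

text \<open>Components are contracted one at a time, and the prices \<open>2 * card inner\<close>
  add up to \<open>2 * card B\<close>. An edge neither deleted nor kept in \<open>F'\<close> has
  both ends identified by \<open>r\<close>.\<close>

lemma contract_all:
  assumes "finite F" "B \<subseteq> F" "game_invariant N F t h \<phi>" "card B < N"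
  shows "\<exists>Y F' r. Y \<subseteq> F - B \<and> card Y \<le> 2 * card B \<and> F' \<subseteq> F - B - Y \<and>
    (\<forall>e\<in>F - Y - F'. r (t e) = r (h e)) \<and> game_invariant N F' (r \<circ> t) (r \<circ> h) \<phi> \<and>
    (\<forall>c. \<phi> c = 0 \<longrightarrow> \<phi> (r c) = 0) \<and> (\<forall>c. \<phi> c = N \<longrightarrow> \<phi> (r c) = N)"
  using assms
proof (induction "card B" arbitrary: F B t h rule: less_induct)
  case less
  have fB: "finite B" using less.prems finite_subset by auto
  show ?case
  proof (cases "B = {}")
    case True
    then show ?thesis using less.prems by (intro exI[of _ "{}"] exI[of _ F] exI[of _ id]) auto
  next
    case False
    then obtain e0 where e0: "e0 \<in> B" by auto
    obtain C where C: "t e0 \<in> C" "breaker_component N F B t h \<phi> C"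
      using component_exists[OF fB] less.prems by metis
    interpret breaker_component N F B t h \<phi> C by (fact C)
    have iB: "inner \<subseteq> B" "e0 \<in> inner" using e0 C by (auto simp: inner_def)
    have "card inner < N" using card_mono[OF fB iB(1)] less.prems by auto
    moreover have "C \<noteq> {}" using C(1) by auto
    ultimately obtain Y c0 where Y: "c0 \<in> C"
        "Y \<subseteq> {e\<in>F. (t e \<in> C) \<noteq> (h e \<in> C)}" "card Y \<le> 2 * card inner"
      and inv': "game_invariant N {e\<in>F - Y. \<not> (t e \<in> C \<and> h e \<in> C)}
         (collapse C c0 \<circ> t) (collapse C c0 \<circ> h) \<phi>"
      and ph: "\<And>c. \<phi> c = 0 \<Longrightarrow> \<phi> (collapse C c0 c) = 0" "\<And>c. \<phi> c = N \<Longrightarrow> \<phi> (collapse C c0 c) = N"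
      by - (rule contract_component; assumption?; rule that; assumption)
    let ?r = "collapse C c0"
    let ?F = "{e\<in>F - Y. \<not> (t e \<in> C \<and> h e \<in> C)}"
    let ?B = "B - inner"
    \<comment> \<open>Deleted edges cross the boundary of \<open>C\<close>, which no edge of Breaker
      does.\<close>
    have BY: "B \<inter> Y = {}" using Y closed by auto
    have cB: "card ?B + card inner = card B"
      using iB fB by (metis card_Diff_subset card_mono finite_subset le_add_diff_inverse2)
    have "card inner > 0" using iB finite_inner card_gt_0_iff by blast
    then have lt: "card ?B < card B" using cB by linarith
    have sub: "?B \<subseteq> ?F" using BY BF closed by (auto simp: inner_def)
    have "finite ?F" using finF by auto
    from less.hyps[OF lt this sub inv'] less.prems lt obtain Y2 F2 r2 where
      2: "Y2 \<subseteq> ?F - ?B" "card Y2 \<le> 2 * card ?B" "F2 \<subseteq> ?F - ?B - Y2"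
      "\<forall>e\<in>?F - Y2 - F2. r2 ((?r \<circ> t) e) = r2 ((?r \<circ> h) e)"
      "game_invariant N F2 (r2 \<circ> (?r \<circ> t)) (r2 \<circ> (?r \<circ> h)) \<phi>"
      "\<forall>c. \<phi> c = 0 \<longrightarrow> \<phi> (r2 c) = 0" "\<forall>c. \<phi> c = N \<longrightarrow> \<phi> (r2 c) = N"
      by auto
    have FB: "?F - ?B \<subseteq> F - B" using inner_ends by auto
    show ?thesis
    proof (rule exI[of _ "Y \<union> Y2"], rule exI[of _ F2], rule exI[of _ "r2 \<circ> ?r"], intro conjI)
      show "Y \<union> Y2 \<subseteq> F - B" using Y 2 FB BY by auto
      show "card (Y \<union> Y2) \<le> 2 * card B" using card_Un_le[of Y Y2] Y 2 cB by linarith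
      show "F2 \<subseteq> F - B - (Y \<union> Y2)" using 2 FB by auto
      show "\<forall>e\<in>F - (Y \<union> Y2) - F2. (r2 \<circ> ?r) (t e) = (r2 \<circ> ?r) (h e)"
      proof
        fix e assume e: "e \<in> F - (Y \<union> Y2) - F2"
        show "(r2 \<circ> ?r) (t e) = (r2 \<circ> ?r) (h e)"
        proof (cases "e \<in> ?F")
          case True then show ?thesis using 2 e by auto
        next
          case False
          then have "t e \<in> C \<and> h e \<in> C" using e by auto
          then show ?thesis by (simp add: collapse_def)
        qed
      qed
      show "game_invariant N F2 (r2 \<circ> ?r \<circ> t) (r2 \<circ> ?r \<circ> h) \<phi>" using 2 by (simp add: o_assoc)
    qed (use 2 ph in auto)
  qed
qed

section \<open>Extracting a crossing from the full board\<close>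

lemma rtranclp_distinct_path:
  assumes "r\<^sup>*\<^sup>* a b"
  shows "\<exists>vs. vs \<noteq> [] \<and> hd vs = a \<and> last vs = b \<and> distinct vs \<and> successively r vs"
  using assms
proof induction
  case base
  show ?case by (rule exI[of _ "[a]"]) simp
next
  case (step y z)
  then obtain vs where vs: "vs \<noteq> []" "hd vs = a" "last vs = y" "distinct vs" "successively r vs"
    by blast
  show ?case
  proof (cases "z \<in> set vs")
    case True
    \<comment> \<open>A walk that returns to \<open>z\<close> is cut off at its earlier
      visit.\<close>
    then obtain us ws where "vs = (us @ [z]) @ ws" by (metis append.assoc append_Cons append_Nil split_list)
    then show ?thesis using vs
      by (intro exI[of _ "us @ [z]"]) (auto simp: successively_append_iff hd_append split: if_splits)
  next
    case False
    then show ?thesis using vs step.hyps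
      by (intro exI[of _ "vs @ [z]"]) (auto simp: successively_append_iff)
  qed
qed

lemma odd_sum_changes:
  fixes b :: "nat \<Rightarrow> bool"
  shows "odd (\<Sum>y<k. of_bool (b y \<noteq> b (Suc y)) :: nat) \<longleftrightarrow> b 0 \<noteq> b k"
  by (induction k) (auto simp del: sum_of_bool_eq)

text \<open>
  The dual vertices marked by \<open>a\<close> form a cut between bottom and top. By parity, the number \<open>H x\<close> of
  cut edges between the columns \<open>x\<close> and \<open>x + 1\<close> that are reached by \<open>R\<close> is odd for every \<open>x\<close>.
\<close>

lemma boundary_reaches_right:
  fixes a R :: "nat \<Rightarrow> nat \<Rightarrow> bool"
  assumes m: "1 \<le> m" and n: "1 \<le> n"
    and bot: "\<And>x. \<not> a x 0" and top: "\<And>x. a x n"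
    and left: "\<And>y. y < n \<Longrightarrow> R 1 (Suc y)"
    and hor: "\<And>x y. 1 \<le> x \<Longrightarrow> x < m \<Longrightarrow> y < n \<Longrightarrow> a x y \<noteq> a x (Suc y) \<Longrightarrow>
      R x (Suc y) = R (Suc x) (Suc y)"
    and ver: "\<And>x y. 1 \<le> x \<Longrightarrow> Suc x < m \<Longrightarrow> 1 \<le> y \<Longrightarrow> y < n \<Longrightarrow> a x y \<noteq> a (Suc x) y \<Longrightarrow>
      R (Suc x) y = R (Suc x) (Suc y)"
  shows "\<exists>y<n. R m (Suc y)"
proof (cases "m = 1")
  case True
  then show ?thesis using n left[of 0] by (intro exI[of _ 0]) auto
next
  case False
  define H where "H = (\<lambda>x. \<Sum>y<n. of_bool (R x (Suc y) \<and> a x y \<noteq> a x (Suc y)) :: nat)"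
  have "odd (H x)" if "1 \<le> x" "x < m" for x
    using that
  proof (induction x rule: nat_induct_at_least)
    case base
    \<comment> \<open>\<open>R\<close> holds on the whole first column, so \<open>H 1\<close> counts
      all changes of \<open>a\<close> on the way from bottom to top.\<close>
    have "H 1 = (\<Sum>y<n. of_bool (a 1 y \<noteq> a 1 (Suc y)))"
      unfolding H_def using left by (intro sum.cong) auto
    then show ?case using odd_sum_changes[of "a 1" n] bot top by simp
  next
    case (Suc x)
    let ?X = "Suc x"
    let ?S = "\<lambda>z k. \<Sum>y<k. of_bool (R ?X (Suc y) \<and> a z y \<noteq> a z (Suc y)) :: nat"
    \<comment> \<open>\<open>?S x k\<close> and \<open>?S ?X k\<close> count the reached cut edges
      to the left and to the right of column \<open>?X\<close> up to height \<open>k\<close>. Every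
      vertex meets an even number of cut edges, so a difference in parity is carried by the vertical
      edge above height \<open>k\<close>. At \<open>k = n\<close> there is none.\<close>
    have "(odd (?S x k) \<noteq> odd (?S ?X k)) \<longleftrightarrow> R ?X k \<and> a x k \<noteq> a ?X k" if "k \<le> n" for k
      using that
    proof (induction k)
      case 0
      then show ?case using bot by simp
    next
      case (Suc k)
      have "R ?X k = R ?X (Suc k)" if "a x k \<noteq> a ?X k"
      proof -
        have "1 \<le> k" using that bot by (cases k) auto
        then show ?thesis using ver[of x k] that Suc.prems \<open>1 \<le> x\<close> \<open>Suc x < m\<close> by auto
      qed
      moreover have "odd (?S z (Suc k)) \<longleftrightarrow> odd (?S z k) \<noteq> (R ?X (Suc k) \<and> a z k \<noteq> a z (Suc k))" for z
        by (auto simp del: sum_of_bool_eq)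
      moreover have "(odd (?S x k) \<noteq> odd (?S ?X k)) \<longleftrightarrow> R ?X k \<and> a x k \<noteq> a ?X k"
        using Suc by simp
      ultimately show ?case by blast
    qed
    from this[of n] have "odd (?S x n) = odd (H ?X)" unfolding H_def using top by blast
    moreover have "of_bool (R ?X (Suc y) \<and> a x y \<noteq> a x (Suc y)) =
        (of_bool (R x (Suc y) \<and> a x y \<noteq> a x (Suc y)) :: nat)" if "y < n" for y
      using hor[of x y] that \<open>1 \<le> x\<close> \<open>Suc x < m\<close> by (cases "a x y = a x (Suc y)") auto
    then have "?S x n = H x" unfolding H_def by (intro sum.cong) auto
    ultimately show ?case using Suc.IH \<open>Suc x < m\<close> by (metis Suc_lessD)
  qed
  from this[of "m - 1"] have "odd (H (m - 1))" using False m by auto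
  then have "H (m - 1) \<noteq> 0" by (metis even_zero)
  then obtain y where "y < n" "R (m - 1) (Suc y)" "a (m - 1) y \<noteq> a (m - 1) (Suc y)"
    unfolding H_def by (auto simp del: sum_of_bool_eq split: if_splits)
  then show ?thesis using hor[of "m - 1" y] False m by auto
qed

section \<open>The dual of the grid\<close>

text \<open>
  The dual vertex \<open>(x, y)\<close> is the unit square with lower left corner \<open>(x, y)\<close>. The edge from
  \<open>(x, y)\<close> to \<open>(x + 1, y)\<close> separates \<open>(x, y - 1)\<close> from \<open>(x, y)\<close>, and the edge from \<open>(x, y)\<close>
  to \<open>(x, y + 1)\<close> separates \<open>(x - 1, y)\<close> from \<open>(x, y)\<close>; the formulas below cover both cases.
\<close>

definition dual_tail :: "(nat \<times> nat) set \<Rightarrow> nat \<times> nat" where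
  "dual_tail e = (Max (fst ` e) - 1, Max (snd ` e) - 1)"

definition dual_head :: "(nat \<times> nat) set \<Rightarrow> nat \<times> nat" where
  "dual_head e = (Min (fst ` e), Min (snd ` e))"

lemma finite_grid_edges: "finite (grid_edges m n)"
proof (rule finite_subset)
  show "grid_edges m n \<subseteq> Pow (grid_vertices m n)" by (auto simp: grid_edges_def)
qed (simp add: grid_vertices_def)

lemma horizontal_edge:
  assumes "1 \<le> x" "x < m" "1 \<le> y" "y \<le> n"
  shows "{(x, y), (Suc x, y)} \<in> grid_edges m n"
  unfolding grid_edges_def mem_Collect_eq using assms
  by (intro exI[of _ x] exI[of _ y] exI[of _ "Suc x"] conjI)
    (auto simp: grid_vertices_def dist_Pair_Pair dist_real_def)

lemma vertical_edge:
  assumes "1 \<le> x" "x \<le> m" "1 \<le> y" "y < n"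
  shows "{(x, y), (x, Suc y)} \<in> grid_edges m n"
  unfolding grid_edges_def mem_Collect_eq using assms
  by (intro exI[of _ x] exI[of _ y] exI[of _ "Suc y"] conjI)
    (auto simp: grid_vertices_def dist_Pair_Pair dist_real_def)

lemma grid_edge_cases:
  assumes "e \<in> grid_edges m n"
  obtains (hor) x y where "e = {(x, y), (Suc x, y)}" "1 \<le> x" "Suc x \<le> m" "1 \<le> y" "y \<le> n"
    | (ver) x y where "e = {(x, y), (x, Suc y)}" "1 \<le> x" "x \<le> m" "1 \<le> y" "Suc y \<le> n"
proof -
  obtain x y x' y' where e: "e = {(x, y), (x', y')}"
    and v: "(x, y) \<in> grid_vertices m n" "(x', y') \<in> grid_vertices m n"
    and d: "dist (real x, real y) (real x', real y') = 1"
    using assms by (auto simp: grid_edges_def)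
  have "(real x - real x')\<^sup>2 + (real y - real y')\<^sup>2 = 1"
    using d by (simp add: dist_Pair_Pair dist_real_def)
  \<comment> \<open>Over the integers, squares with sum 1 leave only the four unit
    displacements.\<close>
  then have "real_of_int ((int x - int x')\<^sup>2 + (int y - int y')\<^sup>2) = real_of_int 1" by simp
  then have sq: "(int x - int x')\<^sup>2 + (int y - int y')\<^sup>2 = 1" by (simp only: of_int_eq_iff)
  then have "(int x - int x')\<^sup>2 \<le> 1" "(int y - int y')\<^sup>2 \<le> 1"
    by (smt (verit) zero_le_power2)+
  then have "\<bar>int x - int x'\<bar> \<le> 1" "\<bar>int y - int y'\<bar> \<le> 1" by (simp_all add: abs_square_le_1)
  then have "int x - int x' \<in> {-1, 0, 1}" "int y - int y' \<in> {-1, 0, 1}" by auto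
  then have "x' = Suc x \<and> y' = y \<or> x = Suc x' \<and> y' = y \<or> x' = x \<and> y' = Suc y \<or> x' = x \<and> y = Suc y'"
    using sq by auto
  then show ?thesis
    using that e v by (auto simp: grid_vertices_def insert_commute)
qed

lemma dual_ends [simp]:
  "dual_tail {(x, y), (Suc x, y)} = (x, y - 1)"
  "dual_head {(x, y), (Suc x, y)} = (x, y)"
  "dual_tail {(x, y), (x, Suc y)} = (x - 1, y)"
  "dual_head {(x, y), (x, Suc y)} = (x, y)"
  by (auto simp: dual_tail_def dual_head_def)

text \<open>
  \<open>M\<close> are the edges of Maker, \<open>U\<close> the unclaimed ones, and \<open>\<kappa>\<close> maps a dual vertex to a
  representative of its contracted vertex.
\<close>

definition crossing_state ::
    "nat \<Rightarrow> nat \<Rightarrow> nat \<Rightarrow> (nat \<times> nat) set set \<Rightarrow> (nat \<times> nat) set set \<Rightarrow> bool" where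
  "crossing_state m n N M U \<longleftrightarrow>
     (\<exists>F (\<kappa> :: nat \<times> nat \<Rightarrow> nat \<times> nat) \<phi>. F \<subseteq> U \<and>
        game_invariant N F (\<kappa> \<circ> dual_tail) (\<kappa> \<circ> dual_head) \<phi> \<and>
        (\<forall>e\<in>grid_edges m n - M - F. \<kappa> (dual_tail e) = \<kappa> (dual_head e)) \<and>
        (\<forall>x. \<phi> (\<kappa> (x, 0)) = 0) \<and> (\<forall>x. \<phi> (\<kappa> (x, n)) = N))"

text \<open>The potential is the height of a square, cut off at \<open>N\<close>. Each square has at
  most one upward and one rightward dual edge out, and only the upward one can rise. Bottom and top
  remain separate squares \<open>(x, 0)\<close> and \<open>(x, n)\<close>, which keeps the degrees
  at 2.\<close>

lemma crossing_state_start: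
  assumes "N \<le> n"
  shows "crossing_state m n N {} (grid_edges m n)"
proof -
  let ?\<phi> = "\<lambda>c :: nat \<times> nat. min (snd c) N"
  let ?E = "grid_edges m n"
  have out: "{e\<in>?E. dual_tail e = c} \<subseteq>
      {{(fst c, Suc (snd c)), (Suc (fst c), Suc (snd c))}, {(Suc (fst c), snd c), (Suc (fst c), Suc (snd c))}}" for c
  proof
    fix e assume "e \<in> {e\<in>?E. dual_tail e = c}"
    then have "e \<in> ?E" and c: "c = dual_tail e" by auto
    then show "e \<in> {{(fst c, Suc (snd c)), (Suc (fst c), Suc (snd c))}, {(Suc (fst c), snd c), (Suc (fst c), Suc (snd c))}}"
      by (cases rule: grid_edge_cases) auto
  qed
  have steep: "{e\<in>?E. dual_tail e = c \<and> ?\<phi> c < ?\<phi> (dual_head e)} \<subseteq>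
      {{(fst c, Suc (snd c)), (Suc (fst c), Suc (snd c))}}" for c
  proof
    fix e assume e: "e \<in> {e\<in>?E. dual_tail e = c \<and> ?\<phi> c < ?\<phi> (dual_head e)}"
    then have "e \<in> ?E" and c: "c = dual_tail e" by auto
    then show "e \<in> {{(fst c, Suc (snd c)), (Suc (fst c), Suc (snd c))}}"
      using e by (cases rule: grid_edge_cases) auto
  qed
  have ins: "{e\<in>?E. dual_head e = c} \<subseteq> {{c, (Suc (fst c), snd c)}, {c, (fst c, Suc (snd c))}}" for c
  proof
    fix e assume "e \<in> {e\<in>?E. dual_head e = c}"
    then have "e \<in> ?E" and c: "c = dual_head e" by auto
    then show "e \<in> {{c, (Suc (fst c), snd c)}, {c, (fst c, Suc (snd c))}}"
      by (cases rule: grid_edge_cases) auto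
  qed
  have two: "card S \<le> 2" if "S \<subseteq> {A, B}" for S and A B :: "(nat \<times> nat) set"
  proof -
    have "card S \<le> card {A, B}" using that by (intro card_mono) auto
    also have "\<dots> \<le> 2" by (simp add: card_insert_if)
    finally show ?thesis .
  qed
  have one: "card S \<le> 1" if "S \<subseteq> {A}" for S and A :: "(nat \<times> nat) set"
    using card_mono[OF _ that] by simp
  have "game_invariant N ?E (id \<circ> dual_tail) (id \<circ> dual_head) ?\<phi>"
    unfolding game_invariant_def id_o
  proof (intro conjI allI ballI impI)
    fix e assume "e \<in> ?E"
    then show "if ?\<phi> (dual_tail e) = N then N \<le> ?\<phi> (dual_head e) + 1
       else ?\<phi> (dual_tail e) \<le> ?\<phi> (dual_head e) \<and> ?\<phi> (dual_head e) \<le> ?\<phi> (dual_tail e) + 1"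
      by (cases rule: grid_edge_cases) (auto simp: min_def)
  next
    fix c show "card {e\<in>?E. dual_tail e = c} \<le> 2" by (rule two[OF out])
    show "card {e\<in>?E. dual_head e = c} \<le> 2" by (rule two[OF ins])
    show "card {e\<in>?E. dual_tail e = c \<and> ?\<phi> c < ?\<phi> (dual_head e)} \<le> 1" by (rule one[OF steep])
  qed auto
  then show ?thesis
    unfolding crossing_state_def using assms
    by (intro exI[of _ ?E] exI[of _ id] exI[of _ ?\<phi>]) auto
qed

text \<open>Edges of \<open>X\<close> outside \<open>F\<close> join vertices that are already
  identified, so only \<open>X \<inter> F\<close> is contracted. \<open>Y0\<close> is Maker's
  compulsory reply. Larger replies are allowed because the rules fix the number of edges she claims,
  and discarding further edges of \<open>F\<close> preserves the invariant.\<close>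

lemma crossing_state_step:
  assumes st: "crossing_state m n N M U" and finU: "finite U" and X: "X \<subseteq> U" "card X < N"
  obtains Y0 where "Y0 \<subseteq> U - X" "card Y0 \<le> 2 * card X"
    "\<And>Y. Y0 \<subseteq> Y \<Longrightarrow> Y \<subseteq> U - X \<Longrightarrow> crossing_state m n N (M \<union> Y) (U - X - Y)"
proof -
  obtain F \<phi> and \<kappa> :: "nat \<times> nat \<Rightarrow> nat \<times> nat" where F: "F \<subseteq> U"
    "game_invariant N F (\<kappa> \<circ> dual_tail) (\<kappa> \<circ> dual_head) \<phi>"
    "\<forall>e\<in>grid_edges m n - M - F. \<kappa> (dual_tail e) = \<kappa> (dual_head e)"
    "\<forall>x. \<phi> (\<kappa> (x, 0)) = 0" "\<forall>x. \<phi> (\<kappa> (x, n)) = N"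
    using st unfolding crossing_state_def by blast
  have finF: "finite F" using F(1) finU finite_subset by blast
  have "finite X" using X(1) finU finite_subset by blast
  then have cX: "card (X \<inter> F) \<le> card X" by (intro card_mono) auto
  have "card (X \<inter> F) < N" using cX X by simp
  from contract_all[OF finF _ F(2) this] obtain Y0 F' r where
    Y0: "Y0 \<subseteq> F - (X \<inter> F)" "card Y0 \<le> 2 * card (X \<inter> F)" "F' \<subseteq> F - (X \<inter> F) - Y0"
    "\<forall>e\<in>F - Y0 - F'. r ((\<kappa> \<circ> dual_tail) e) = r ((\<kappa> \<circ> dual_head) e)"
    "game_invariant N F' (r \<circ> (\<kappa> \<circ> dual_tail)) (r \<circ> (\<kappa> \<circ> dual_head)) \<phi>"
    "\<forall>c. \<phi> c = 0 \<longrightarrow> \<phi> (r c) = 0" "\<forall>c. \<phi> c = N \<longrightarrow> \<phi> (r c) = N"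
    by blast
  show ?thesis
  proof (rule that)
    show "Y0 \<subseteq> U - X" using Y0 F by auto
    show "card Y0 \<le> 2 * card X" using Y0 cX by linarith
    fix Y assume Y: "Y0 \<subseteq> Y" "Y \<subseteq> U - X"
    have finF': "finite F'" using Y0(3) finF by (meson finite_Diff finite_subset)
    have inv: "game_invariant N (F' - Y) (r \<circ> \<kappa> \<circ> dual_tail) (r \<circ> \<kappa> \<circ> dual_head) \<phi>"
      using game_invariant_mono[OF Y0(5) _ finF', of "F' - Y"] by (simp add: o_assoc)
    have "(r \<circ> \<kappa>) (dual_tail e) = (r \<circ> \<kappa>) (dual_head e)"
      if "e \<in> grid_edges m n - (M \<union> Y) - (F' - Y)" for e
    proof (cases "e \<in> F")
      case True
      then show ?thesis using that Y Y0(4) by auto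
    next
      case False
      then show ?thesis using that F(3) by auto
    qed
    moreover have "F' - Y \<subseteq> U - X - Y" using F(1) Y0(3) by auto
    moreover have "\<forall>x. \<phi> ((r \<circ> \<kappa>) (x, 0)) = 0" "\<forall>x. \<phi> ((r \<circ> \<kappa>) (x, n)) = N"
      using F(4,5) Y0(6,7) by (metis comp_apply)+
    ultimately show "crossing_state m n N (M \<union> Y) (U - X - Y)"
      unfolding crossing_state_def using inv by blast
  qed
qed

text \<open>With nothing unclaimed \<open>F\<close> is empty, so an edge whose two sides differ in
  \<open>a\<close> must belong to Maker.\<close>

lemma crossing_state_full_board:
  assumes st: "crossing_state m n N M {}" and "1 \<le> m" "1 \<le> n" "1 \<le> N"
  shows "\<exists>S\<in>crossing_edge_sets m n. S \<subseteq> M"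
proof -
  obtain \<phi> and \<kappa> :: "nat \<times> nat \<Rightarrow> nat \<times> nat" where
    \<kappa>: "\<And>e. e \<in> grid_edges m n \<Longrightarrow> e \<notin> M \<Longrightarrow> \<kappa> (dual_tail e) = \<kappa> (dual_head e)"
    and bot: "\<And>x. \<phi> (\<kappa> (x, 0)) = 0" and top: "\<And>x. \<phi> (\<kappa> (x, n)) = N"
    using st unfolding crossing_state_def by auto
  define a where "a = (\<lambda>x y. \<phi> (\<kappa> (x, y)) = N)"
  define adj where "adj = (\<lambda>u v. {u, v} \<in> grid_edges m n \<inter> M \<and> v \<in> grid_vertices m n)"
  define R where "R = (\<lambda>x y. \<exists>y0\<in>{1..n}. adj\<^sup>*\<^sup>* (1, y0) (x, y))"
  have sym: "R x y = R x' y'"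
    if "{(x, y), (x', y')} \<in> grid_edges m n" "{(x, y), (x', y')} \<in> M"
      "(x, y) \<in> grid_vertices m n" "(x', y') \<in> grid_vertices m n" for x y x' y'
  proof -
    have "adj (x, y) (x', y')" "adj (x', y') (x, y)" using that by (auto simp: adj_def insert_commute)
    then show ?thesis unfolding R_def by (meson rtranclp.rtrancl_into_rtrancl)
  qed
  have "\<exists>y<n. R m (Suc y)"
  proof (rule boundary_reaches_right[where a = a])
    show "\<not> a x 0" "a x n" for x using bot top assms by (auto simp: a_def)
    show "R 1 (Suc y)" if "y < n" for y
      unfolding R_def using that by (intro bexI[of _ "Suc y"]) auto
    show "R x (Suc y) = R (Suc x) (Suc y)"
      if "1 \<le> x" "x < m" "y < n" "a x y \<noteq> a x (Suc y)" for x y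
    proof (rule sym)
      show *: "{(x, Suc y), (Suc x, Suc y)} \<in> grid_edges m n" using that by (intro horizontal_edge) auto
      show "{(x, Suc y), (Suc x, Suc y)} \<in> M" using \<kappa>[OF *] that(4) by (fastforce simp: a_def)
    qed (use that in \<open>auto simp: grid_vertices_def\<close>)
    show "R (Suc x) y = R (Suc x) (Suc y)"
      if "1 \<le> x" "Suc x < m" "1 \<le> y" "y < n" "a x y \<noteq> a (Suc x) y" for x y
    proof (rule sym)
      show *: "{(Suc x, y), (Suc x, Suc y)} \<in> grid_edges m n" using that by (intro vertical_edge) auto
      show "{(Suc x, y), (Suc x, Suc y)} \<in> M" using \<kappa>[OF *] that(5) by (fastforce simp: a_def)
    qed (use that in \<open>auto simp: grid_vertices_def\<close>)
  qed fact+
  then obtain y0 y where y0: "y0 \<in> {1..n}" and "adj\<^sup>*\<^sup>* (1, y0) (m, Suc y)"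
    unfolding R_def by blast
  from rtranclp_distinct_path[OF this(2)] obtain vs where
    vs: "vs \<noteq> []" "hd vs = (1, y0)" "last vs = (m, Suc y)" "distinct vs" "successively adj vs"
    by blast
  have adj: "adj (vs ! i) (vs ! Suc i)" if "Suc i < length vs" for i
    using vs(5) that by (auto simp: successively_conv_nth)
  have "vs ! i \<in> grid_vertices m n" if "i < length vs" for i
  proof (cases i)
    case 0
    then show ?thesis using vs y0 \<open>1 \<le> m\<close> by (simp add: hd_conv_nth[symmetric] grid_vertices_def)
  next
    case (Suc j)
    then show ?thesis using adj[of j] that by (simp add: adj_def)
  qed
  then have "set vs \<subseteq> grid_vertices m n" by (metis in_set_conv_nth subsetI)
  moreover have "successively (\<lambda>u v. {u, v} \<in> grid_edges m n) vs"
    using adj by (auto simp: successively_conv_nth adj_def)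
  ultimately have "left_right_crossing m n vs"
    using vs by (simp add: left_right_crossing_def grid_path_def)
  moreover have "path_edges vs \<subseteq> M" using adj by (auto simp: path_edges_def adj_def)
  ultimately show ?thesis unfolding crossing_edge_sets_def by blast
qed

section \<open>Histories, exhaustion of the board, and Maker's strategy\<close>

lemma maker_claimed_snoc:
  fixes h :: "'a set list"
  shows "maker_claimed (h @ [X]) = (if even (length h) then maker_claimed h \<union> X else maker_claimed h)"
proof -
  let ?T = "\<lambda>n :: nat. {t. t < n \<and> even t}"
  have claimed: "maker_claimed g = (\<Union>t\<in>?T (length g). g ! t)" for g :: "'a set list"
    by (auto simp: maker_claimed_def)
  have "?T (Suc n) = (if even n then insert n (?T n) else ?T n)" for n
    by (auto simp: less_Suc_eq)
  moreover have "(\<Union>t\<in>?T (length h). (h @ [X]) ! t) = (\<Union>t\<in>?T (length h). h ! t)"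
    by (intro SUP_cong) (auto simp: nth_append)
  ultimately show ?thesis unfolding claimed by (simp add: Un_commute)
qed

lemma unclaimed_snoc: "unclaimed E (h @ [X]) = unclaimed E h - X"
  by (auto simp: unclaimed_def)

lemma history_Suc: "history w (Suc t) = history w t @ [w t]"
  by (simp add: history_def)

lemma length_history [simp]: "length (history w t) = t"
  by (simp add: history_def)

lemma legal_move_exists:
  assumes "finite E"
  shows "\<exists>X. legal_move E k h X"
proof -
  have "finite (unclaimed E h)" using assms by (simp add: unclaimed_def)
  then show ?thesis
    using obtain_subset_with_card_n[of "min k (card (unclaimed E h))" "unclaimed E h"]
    unfolding legal_move_def by (metis min.cobounded2)
qed

text \<open>Each turn takes at least one element while any is left, so every play fills the board
  within \<open>card E\<close> turns.\<close>

lemma card_unclaimed_le: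
  assumes "legal_play E p q w" "finite E" "p \<ge> 1" "q \<ge> 1"
  shows "card (unclaimed E (history w t)) \<le> card E - t"
proof (induction t)
  case 0
  then show ?case by (simp add: unclaimed_def history_def)
next
  case (Suc t)
  let ?U = "unclaimed E (history w t)"
  have fin: "finite ?U" using assms(2) by (simp add: unclaimed_def)
  have lm: "w t \<subseteq> ?U" "card (w t) = min (bias p q t) (card ?U)"
    using assms(1) by (auto simp: legal_play_def legal_move_def)
  have "bias p q t \<ge> 1" using assms by (simp add: bias_def)
  then have "card (w t) \<ge> min 1 (card ?U)" using lm by simp
  moreover have "card (?U - w t) = card ?U - card (w t)"
    using lm fin by (metis card_Diff_subset finite_subset)
  ultimately show ?case using Suc by (simp add: history_Suc unclaimed_snoc min_def split: if_splits)
qed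

theorem theorem1p1:
  fixes m n p q :: nat
  assumes "m \<ge> 1" and "n \<ge> 1" and "p \<ge> 1" and "q \<ge> 1"
    and "p \<ge> 2 * q" and "n \<ge> q + 1"
  shows "maker_wins_crossing_game p q m n"
proof -
  define E where "E = grid_edges m n"
  \<comment> \<open>The least height that \<open>q\<close> edges of Breaker cannot span; it fits
    below \<open>n\<close>.\<close>
  define N where "N = q + 1"
  define good where "good = (\<lambda>h. crossing_state m n N (maker_claimed h) (unclaimed E h))"
  \<comment> \<open>A strategy must be legal on every history, so a legal move is chosen in any
    case, and one that reaches a good position whenever this is possible.\<close>
  define \<sigma> where "\<sigma> = (\<lambda>h. SOME Y. legal_move E p h Y \<and>
    ((\<exists>Y. legal_move E p h Y \<and> good (h @ [Y])) \<longrightarrow> good (h @ [Y])))"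
  have finE: "finite E" by (simp add: E_def finite_grid_edges)
  have finU: "finite (unclaimed E h)" for h using finE by (simp add: unclaimed_def)
  have \<sigma>: "legal_move E p h (\<sigma> h) \<and>
    ((\<exists>Y. legal_move E p h Y \<and> good (h @ [Y])) \<longrightarrow> good (h @ [\<sigma> h]))" for h
    unfolding \<sigma>_def
    by (rule someI_ex) (use legal_move_exists[OF finE, of p h] in blast)
  have "maker_wins (crossing_edge_sets m n) w" if play: "legal_play E p q w" and fol: "follows \<sigma> w" for w
  proof -
    have good: "good (history w (Suc (2 * k)))" for k
    proof (induction k)
      case 0
      obtain Y where Y: "legal_move E p [] Y" using legal_move_exists[OF finE] by blast
      have "crossing_state m n N {} E" using crossing_state_start assms by (simp add: N_def E_def)
      then obtain Y0 where Y0: "Y0 \<subseteq> E - {}" "card Y0 \<le> 2 * card ({} :: (nat \<times> nat) set set)"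
        "\<And>Y. Y0 \<subseteq> Y \<Longrightarrow> Y \<subseteq> E - {} \<Longrightarrow> crossing_state m n N ({} \<union> Y) (E - {} - Y)"
        using crossing_state_step[of m n N "{}" E "{}"] finE by (auto simp: N_def)
      \<comment> \<open>Before Breaker has moved nothing is compulsory, so any legal opening is
        good.\<close>
      have "Y0 = {}" using Y0(1,2) finE finite_subset by fastforce
      then have "good ([] @ [Y])"
        using Y0(3)[of Y] Y maker_claimed_snoc[of "[]" Y]
        by (simp add: good_def legal_move_def unclaimed_def maker_claimed_def)
      then have "good ([] @ [\<sigma> []])" using \<sigma> Y by blast
      moreover have "w 0 = \<sigma> []" using fol by (auto simp: follows_def history_def)
      ultimately show ?case by (simp add: history_def)
    next
      case (Suc k)
      let ?t = "Suc (2 * k)"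
      let ?h = "history w ?t"
      let ?U = "unclaimed E ?h"
      let ?X = "w ?t"
      have X: "?X \<subseteq> ?U" "card ?X = min (bias p q ?t) (card ?U)"
        using play by (auto simp: legal_play_def legal_move_def)
      then have cX: "card ?X \<le> q" by (simp add: bias_def)
      then have "card ?X < N" by (simp add: N_def)
      from crossing_state_step[OF Suc[unfolded good_def] finU X(1) this] obtain Y0 where
        Y0: "Y0 \<subseteq> ?U - ?X" "card Y0 \<le> 2 * card ?X"
        "\<And>Y. Y0 \<subseteq> Y \<Longrightarrow> Y \<subseteq> ?U - ?X \<Longrightarrow>
          crossing_state m n N (maker_claimed ?h \<union> Y) (?U - ?X - Y)" by blast
      let ?h' = "history w (Suc ?t)"
      have h': "unclaimed E ?h' = ?U - ?X" "maker_claimed ?h' = maker_claimed ?h"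
        by (simp_all add: history_Suc[of w ?t] unclaimed_snoc maker_claimed_snoc)
      \<comment> \<open>The bias condition enters here: the reply costs at most
        \<open>2 * q\<close>, hence at most \<open>p\<close>.\<close>
      have "card Y0 \<le> min p (card (?U - ?X))"
        using Y0 cX assms finU by (auto intro: card_mono)
      then obtain Y where Y: "Y0 \<subseteq> Y" "Y \<subseteq> ?U - ?X" "card Y = min p (card (?U - ?X))"
        using exists_subset_between[of Y0 "min p (card (?U - ?X))" "?U - ?X"] Y0 finU by auto
      have "legal_move E p ?h' Y" using Y h' by (simp add: legal_move_def)
      moreover have "good (?h' @ [Y])"
        using Y0(3)[OF Y(1,2)] h' by (simp add: good_def maker_claimed_snoc unclaimed_snoc)
      ultimately have "good (?h' @ [\<sigma> ?h'])" using \<sigma> by blast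
      moreover have "w (Suc ?t) = \<sigma> ?h'" using fol by (simp add: follows_def)
      ultimately show ?case using history_Suc[of w "Suc ?t"] by simp
    qed
    \<comment> \<open>Late enough for the board to be full, and odd, so that the last turn was
      Maker's.\<close>
    let ?t = "Suc (2 * card E)"
    have "card (unclaimed E (history w ?t)) = 0"
      using card_unclaimed_le[OF play finE assms(3,4), of ?t] by simp
    then have "unclaimed E (history w ?t) = {}" using finU by simp
    then have "crossing_state m n N (maker_claimed (history w ?t)) {}"
      using good[of "card E"] by (simp add: good_def)
    then have "\<exists>S\<in>crossing_edge_sets m n. S \<subseteq> maker_claimed (history w ?t)"
      using assms by (intro crossing_state_full_board[of m n N]) (auto simp: N_def)
    then show ?thesis unfolding maker_wins_def by blast
  qed
  then have "maker_winning_strategy E (crossing_edge_sets m n) p q \<sigma>"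
    using \<sigma> by (auto simp: maker_winning_strategy_def maker_strategy_def)
  then show ?thesis unfolding maker_wins_crossing_game_def E_def by blast
qed

end
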